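(* Let $p\ge 1$ and, for density matrices $\rho,\sigma$ on a finite-dimensional complex Hilbert space, define $$\mathcal{F}_p(\rho,\sigma)=\frac{\|\sqrt{\rho}\sqrt{\sigma}\|_p^{2}}{\max[\|\sigma\|_p^{2},\|\rho\|_p^{2}]},\qquad \|A\|_p=\left(\operatorname{tr}\big[(AA^{\dagger})^{p/2}\big]\right)^{1/p}.$$ Then for all density matrices $\rho,\sigma$ on that space: (J1a) $\mathcal{F}_p(\rho,\sigma)\in[0,1]$; (J1b) $\mathcal{F}_p(\rho,\sigma)=1$ if and only if $\rho=\sigma$; (J1c) $\mathcal{F}_p(\rho,\sigma)=0$ if and only if $\rho\sigma=0$; (J2) $\mathcal{F}_p(\rho,\sigma)=\mathcal{F}_p(\sigma,\rho)$; (J3) $\mathcal{F}_p(\rho,\sigma)=\operatorname{tr}(\rho\sigma)$ whenever $\rho$ or $\sigma$ is a pure state (a rank-one projector); (J4) $\mathcal{F}_p(U\rho U^{\dagger},U\sigma U^{\dagger})=\mathcal{F}_p(\rho,\sigma)$ for every unitary $U$.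
   Context: A density matrix is a positive semidefinite operator of unit trace; $\sqrt{\rho}$ denotes the positive semidefinite square root. $\|\cdot\|_p$ is the Schatten $p$-norm. *)

theory Defs
  imports Complex_Main "Jordan_Normal_Form.Matrix"
begin

definition adj :: "complex mat \<Rightarrow> complex mat" where
  "adj A = mat (dim_col A) (dim_row A) (\<lambda>(i,j). cnj (A $$ (j,i)))"

definition tr :: "complex mat \<Rightarrow> complex" where
  "tr A = (\<Sum>i<dim_row A. A $$ (i,i))"

definition psd :: "nat \<Rightarrow> complex mat \<Rightarrow> bool" where
  "psd n A \<longleftrightarrow> A \<in> carrier_mat n n \<and> adj A = A \<and>
     (\<forall>v \<in> carrier_vec n. let q = (\<Sum>i<n. cnj (v $ i) * (A *\<^sub>v v) $ i)
                              in Im q = 0 \<and> Re q \<ge> 0)"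

definition density :: "nat \<Rightarrow> complex mat \<Rightarrow> bool" where
  "density n A \<longleftrightarrow> psd n A \<and> tr A = 1"

definition unitary :: "nat \<Rightarrow> complex mat \<Rightarrow> bool" where
  "unitary n U \<longleftrightarrow> U \<in> carrier_mat n n \<and> U * adj U = 1\<^sub>m n \<and> adj U * U = 1\<^sub>m n"

definition rdiag :: "nat \<Rightarrow> (nat \<Rightarrow> real) \<Rightarrow> complex mat" where
  "rdiag n d = mat n n (\<lambda>(i,j). if i = j then complex_of_real (d i) else 0)"

definition pure_state :: "nat \<Rightarrow> complex mat \<Rightarrow> bool" where
  "pure_state n A \<longleftrightarrow> (\<exists>v \<in> carrier_vec n. (\<Sum>i<n. (cmod (v $ i))\<^sup>2) = 1 \<and>
       A = mat n n (\<lambda>(i,j). v $ i * cnj (v $ j)))"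

definition msqrt :: "complex mat \<Rightarrow> complex mat" where
  "msqrt A = (THE B. psd (dim_row A) B \<and> B * B = A)"

(* A^r for a PSD matrix A and real r > 0, via spectral decomposition A = U diag(d) U^\<dagger> *)
definition mat_powr :: "complex mat \<Rightarrow> real \<Rightarrow> complex mat" where
  "mat_powr A r = (SOME B. \<exists>U d. unitary (dim_row A) U \<and> (\<forall>i. d i \<ge> 0) \<and>
       A = U * rdiag (dim_row A) d * adj U \<and>
       B = U * rdiag (dim_row A) (\<lambda>i. d i powr r) * adj U)"

definition schatten :: "real \<Rightarrow> complex mat \<Rightarrow> real" where
  "schatten p A = (Re (tr (mat_powr (A * adj A) (p / 2)))) powr (1 / p)"

definition Fp :: "real \<Rightarrow> complex mat \<Rightarrow> complex mat \<Rightarrow> real" where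
  "Fp p \<rho> \<sigma> = (schatten p (msqrt \<rho> * msqrt \<sigma>))\<^sup>2 /
                 max ((schatten p \<sigma>)\<^sup>2) ((schatten p \<rho>)\<^sup>2)"

end

theory Submission
  imports Defs "Jordan_Normal_Form.Spectral_Radius" "HOL-Analysis.Convex"
begin

text \<open>
  Write the singular value decomposition of \<open>\<surd>\<rho> \<surd>\<sigma>\<close> as \<open>U diag(s) V\<^sup>\<dagger>\<close>. Then \<open>s\<^sub>k\<close> is the inner product
  of the \<open>k\<close>-th columns of \<open>\<surd>\<rho> U\<close> and \<open>\<surd>\<sigma> V\<close>, hence at most \<open>(a\<^sub>k + b\<^sub>k) / 2\<close> where \<open>a\<^sub>k\<close> and \<open>b\<^sub>k\<close> are
  their squared norms, that is, the diagonal entries of \<open>U\<^sup>\<dagger> \<rho> U\<close> and \<open>V\<^sup>\<dagger> \<sigma> V\<close>. Convexity of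
  \<open>x \<mapsto> x\<^sup>p\<close> gives \<open>\<Sum> s\<^sub>k\<^sup>p \<le> (\<Sum> a\<^sub>k\<^sup>p + \<Sum> b\<^sub>k\<^sup>p) / 2 \<le> (tr \<rho>\<^sup>p + tr \<sigma>\<^sup>p) / 2\<close>, the second step being
  Jensen's inequality for the doubly stochastic matrix relating a diagonal to the spectrum.
  If this is an equality with the larger of the two traces, the columns agree, so
  \<open>\<surd>\<rho> U = \<surd>\<sigma> V\<close>, and multiplying by the adjoint yields \<open>\<rho> = \<sigma>\<close>.
\<close>

section \<open>Adjoints and the standard inner product\<close>

text \<open>Conjugate-linear in the first argument. The sum ranges over the dimension of the first
  vector, hence the dimension hypotheses in some of the rules below.\<close>

definition ip :: "complex vec \<Rightarrow> complex vec \<Rightarrow> complex" where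
  "ip v w = (\<Sum>i<dim_vec v. cnj (v $ i) * w $ i)"

text \<open>An arbitrary index set is allowed because the singular value decomposition completes a
  family whose indices need not form an initial segment.\<close>

definition orthonormal_on :: "nat set \<Rightarrow> (nat \<Rightarrow> complex vec) \<Rightarrow> bool" where
  "orthonormal_on K v \<longleftrightarrow> (\<forall>i\<in>K. \<forall>j\<in>K. ip (v i) (v j) = (if i = j then 1 else 0))"

lemma adj_carrier [simp]: "A \<in> carrier_mat n m \<Longrightarrow> adj A \<in> carrier_mat m n"
  by (auto simp: adj_def)

lemma adj_dim [simp]: "dim_row (adj A) = dim_col A" "dim_col (adj A) = dim_row A"
  by (auto simp: adj_def)

lemma adj_index [simp]: "i < dim_col A \<Longrightarrow> j < dim_row A \<Longrightarrow> adj A $$ (i,j) = cnj (A $$ (j,i))"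
  by (auto simp: adj_def)

lemma adj_adj [simp]: "adj (adj A) = A"
  by (rule eq_matI) auto

lemma mult_index_sum:
  "i < dim_row A \<Longrightarrow> j < dim_col B \<Longrightarrow> dim_col A = dim_row B \<Longrightarrow>
    (A * B) $$ (i,j) = (\<Sum>k<dim_row B. A $$ (i,k) * B $$ (k,j))"
  by (auto simp: scalar_prod_def atLeast0LessThan intro!: sum.cong)

lemma mult_vec_index_sum:
  "i < dim_row A \<Longrightarrow> dim_col A = dim_vec v \<Longrightarrow>
    (A *\<^sub>v v) $ i = (\<Sum>k<dim_vec v. A $$ (i,k) * v $ k)"
  by (auto simp: scalar_prod_def atLeast0LessThan intro!: sum.cong)

lemma adj_mult [simp]:
  assumes "dim_col A = dim_row B"
  shows "adj (A * B) = adj B * adj A"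
  using assms by (intro eq_matI) (auto simp: mult_index_sum mult.commute simp del: index_mult_mat(1))

lemma ip_mult_mat_vec:
  assumes "A \<in> carrier_mat n m" "v \<in> carrier_vec n" "w \<in> carrier_vec m"
  shows "ip v (A *\<^sub>v w) = ip (adj A *\<^sub>v v) w"
proof -
  have "ip v (A *\<^sub>v w) = (\<Sum>i<n. \<Sum>j<m. cnj (v $ i) * A $$ (i,j) * w $ j)"
    using assms
    by (auto simp: ip_def mult_vec_index_sum sum_distrib_left mult.assoc
        simp del: index_mult_mat_vec intro!: sum.cong)
  also have "\<dots> = (\<Sum>j<m. \<Sum>i<n. cnj (v $ i) * A $$ (i,j) * w $ j)"
    by (rule sum.swap)
  also have "\<dots> = ip (adj A *\<^sub>v v) w"
    using assms
    by (auto simp: ip_def mult_vec_index_sum sum_distrib_left sum_distrib_right mult_ac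
        simp del: index_mult_mat_vec intro!: sum.cong)
  finally show ?thesis .
qed

lemma cnj_ip: "dim_vec v = dim_vec w \<Longrightarrow> cnj (ip v w) = ip w v"
  by (simp add: ip_def mult.commute)

lemma ip_smult_right: "dim_vec v = dim_vec w \<Longrightarrow> ip v (c \<cdot>\<^sub>v w) = c * ip v w"
  by (simp add: ip_def sum_distrib_left mult_ac)

lemma ip_smult_left: "ip (c \<cdot>\<^sub>v v) w = cnj c * ip v w"
  by (simp add: ip_def sum_distrib_left mult_ac)

lemma ip_self: "ip v v = complex_of_real (\<Sum>i<dim_vec v. (cmod (v $ i))\<^sup>2)"
  by (simp add: ip_def complex_norm_square mult.commute del: of_real_power)

lemma ip_normalized:
  assumes "v \<in> carrier_vec n" "v \<noteq> 0\<^sub>v n"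
  obtains c where "c \<noteq> 0" "ip (c \<cdot>\<^sub>v v) (c \<cdot>\<^sub>v v) = 1"
proof -
  define q where "q = (\<Sum>i<dim_vec v. (cmod (v $ i))\<^sup>2)"
  from assms obtain i where i: "i < n" "v $ i \<noteq> 0"
    by (metis eq_vecI carrier_vecD index_zero_vec)
  have "q > 0" unfolding q_def
    using i assms by (intro sum_pos2[of _ i]) auto
  then have "ip (complex_of_real (1 / sqrt q) \<cdot>\<^sub>v v) (complex_of_real (1 / sqrt q) \<cdot>\<^sub>v v)
      = complex_of_real (1 / sqrt q * (1 / sqrt q) * q)"
    by (simp add: ip_smult_left ip_smult_right ip_self[of v] flip: q_def of_real_mult)
  also have "1 / sqrt q * (1 / sqrt q) * q = 1"
    using \<open>q > 0\<close> by (simp add: field_simps)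
  finally show ?thesis
    using \<open>q > 0\<close> by (intro that[of "complex_of_real (1 / sqrt q)"]) auto
qed

subsection \<open>Orthonormal families\<close>

lemma exists_unit_orthogonal:
  assumes K: "K \<subset> {..<n}" and v: "\<And>k. k \<in> K \<Longrightarrow> v k \<in> carrier_vec n"
  obtains w where "w \<in> carrier_vec n" "ip w w = 1" "\<And>k. k \<in> K \<Longrightarrow> ip (v k) w = 0"
proof -
  define B where "B = mat n n (\<lambda>(i,j). if i \<in> K then cnj (v i $ j) else 0)"
  have B: "B \<in> carrier_mat n n" by (simp add: B_def)
  from K obtain k where k: "k < n" "k \<notin> K" by auto
  \<comment> \<open>The rows indexed outside \<open>K\<close> vanish, so \<open>B\<close> is singular; its kernel is orthogonal to the family.\<close>
  have "B\<^sup>T *\<^sub>v unit_vec n k = 0\<^sub>v n"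
    using k by (intro eq_vecI) (auto simp: B_def)
  then have "det B\<^sup>T = 0"
    using det_0_iff_vec_prod_zero_field[of "B\<^sup>T" n] B k unit_vec_carrier[of n k]
    by (metis transpose_carrier_mat unit_vec_nonzero)
  then have "det B = 0" using det_transpose[OF B] by simp
  then obtain w where w: "w \<in> carrier_vec n" "w \<noteq> 0\<^sub>v n" "B *\<^sub>v w = 0\<^sub>v n"
    using det_0_iff_vec_prod_zero_field[OF B] by blast
  obtain c where c: "ip (c \<cdot>\<^sub>v w) (c \<cdot>\<^sub>v w) = 1"
    using ip_normalized[OF w(1,2)] by blast
  have "ip (v k) w = 0" if "k \<in> K" for k
  proof -
    have kn: "k < n" using that K by auto
    have "ip (v k) w = (B *\<^sub>v w) $ k"
      using that kn w v[OF that] B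
      by (subst mult_vec_index_sum) (auto simp: ip_def B_def)
    then show ?thesis using w kn by simp
  qed
  then show ?thesis
    using w c v by (intro that[of "c \<cdot>\<^sub>v w"]) (auto simp: ip_smult_right)
qed

lemma orthonormal_completion:
  assumes "K \<subseteq> {..<n}" "\<And>k. k \<in> K \<Longrightarrow> v k \<in> carrier_vec n" "orthonormal_on K v"
  shows "\<exists>u. (\<forall>k\<in>K. u k = v k) \<and> (\<forall>k<n. u k \<in> carrier_vec n) \<and> orthonormal_on {..<n} u"
  using assms
proof (induction "card ({..<n} - K)" arbitrary: K v)
  case 0
  then have "K = {..<n}" by auto
  with 0 show ?case by blast
next
  case (Suc m)
  then obtain k where k: "k < n" "k \<notin> K"
    by (metis Diff_eq_empty_iff card.empty lessThan_iff nat.distinct(1) subsetI)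
  then have "K \<subset> {..<n}" using Suc.prems by auto
  then obtain w where w: "w \<in> carrier_vec n" "ip w w = 1" "\<And>j. j \<in> K \<Longrightarrow> ip (v j) w = 0"
    using exists_unit_orthogonal[of K n v] Suc.prems(2) by blast
  have w': "ip w (v j) = 0" if "j \<in> K" for j
    using cnj_ip[of "v j" w] w(1,3) Suc.prems(2) that by auto
  have "card ({..<n} - insert k K) = m"
    using Suc.hyps(2) k by (metis Diff_insert card_Diff_singleton Diff_iff diff_Suc_1 lessThan_iff)
  then have "\<exists>u. (\<forall>j\<in>insert k K. u j = (v(k := w)) j) \<and> (\<forall>j<n. u j \<in> carrier_vec n) \<and> orthonormal_on {..<n} u"
    using Suc.prems k w w'
    by (intro Suc.hyps(1)) (auto simp: orthonormal_on_def)
  then obtain u where u: "\<forall>j\<in>insert k K. u j = (v(k := w)) j" "\<forall>j<n. u j \<in> carrier_vec n" "orthonormal_on {..<n} u"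
    by blast
  have "\<forall>j\<in>K. u j = v j" using u(1) k(2) by (metis fun_upd_other insertCI)
  with u show ?case by blast
qed

definition cols_mat :: "nat \<Rightarrow> (nat \<Rightarrow> complex vec) \<Rightarrow> complex mat" where
  "cols_mat n v = mat n n (\<lambda>(i,j). v j $ i)"

lemma cols_mat_carrier [simp]: "cols_mat n v \<in> carrier_mat n n"
  by (simp add: cols_mat_def)

lemma cols_mat_index [simp]: "i < n \<Longrightarrow> j < n \<Longrightarrow> cols_mat n v $$ (i,j) = v j $ i"
  by (simp add: cols_mat_def)

lemma cols_mat_dim [simp]: "dim_row (cols_mat n v) = n" "dim_col (cols_mat n v) = n"
  by (simp_all add: cols_mat_def)

lemma unitaryI:
  assumes "U \<in> carrier_mat n n" "adj U * U = 1\<^sub>m n"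
  shows "unitary n U"
  using assms mat_mult_left_right_inverse[of "adj U" n U] by (auto simp: unitary_def)

lemma unitary_cols_mat:
  assumes "\<And>k. k < n \<Longrightarrow> u k \<in> carrier_vec n" "orthonormal_on {..<n} u"
  shows "unitary n (cols_mat n u)"
proof (rule unitaryI)
  show "adj (cols_mat n u) * cols_mat n u = 1\<^sub>m n"
  proof (rule eq_matI)
    fix i j assume "i < dim_row (1\<^sub>m n)" "j < dim_col (1\<^sub>m n)"
    then have ij: "i < n" "j < n" by auto
    have "(adj (cols_mat n u) * cols_mat n u) $$ (i,j) = ip (u i) (u j)"
      using ij assms(1)[OF ij(1)] by (subst mult_index_sum) (auto simp: ip_def)
    then show "(adj (cols_mat n u) * cols_mat n u) $$ (i,j) = 1\<^sub>m n $$ (i,j)"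
      using ij assms(2) by (auto simp: orthonormal_on_def)
  qed auto
qed auto

subsection \<open>Spectral theorem\<close>

lemma psd_carrier: "psd n A \<Longrightarrow> A \<in> carrier_mat n n"
  and psd_adj: "psd n A \<Longrightarrow> adj A = A"
  by (auto simp: psd_def)

lemma psd_ip:
  assumes "psd n A" "v \<in> carrier_vec n"
  shows "Im (ip v (A *\<^sub>v v)) = 0" "Re (ip v (A *\<^sub>v v)) \<ge> 0"
  using assms by (auto simp: psd_def ip_def Let_def)

text \<open>Deflation: in an orthonormal basis extending \<open>v\<close>, the matrix
  \<open>A\<close> leaves the span of the remaining vectors invariant. An eigenvector of the
  compression to that span exists over the complex numbers and is an eigenvector of
  \<open>A\<close>.\<close>

lemma psd_new_eigenvector:
  assumes A: "psd n A" and k: "k < n" and v: "\<And>j. j < k \<Longrightarrow> v j \<in> carrier_vec n"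
    and on: "orthonormal_on {..<k} v"
    and ev: "\<And>j. j < k \<Longrightarrow> A *\<^sub>v v j = complex_of_real (d j) \<cdot>\<^sub>v v j"
  shows "\<exists>w e. w \<in> carrier_vec n \<and> ip w w = 1 \<and> (\<forall>j<k. ip (v j) w = 0) \<and>
    A *\<^sub>v w = complex_of_real e \<cdot>\<^sub>v w \<and> e \<ge> 0"
proof -
  have Ac: "A \<in> carrier_mat n n" using A by (rule psd_carrier)
  obtain u where u: "\<And>j. j < k \<Longrightarrow> u j = v j" "\<And>j. j < n \<Longrightarrow> u j \<in> carrier_vec n" "orthonormal_on {..<n} u"
    using orthonormal_completion[of "{..<k}" n v] k v on by auto
  define U where "U = cols_mat n u"
  have U: "unitary n U" unfolding U_def by (rule unitary_cols_mat) (use u in auto)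
  then have Uc: "U \<in> carrier_mat n n" by (simp add: unitary_def)
  \<comment> \<open>This is \<open>A\<close> written in the basis \<open>u\<close>.\<close>
  define B where "B = adj U * A * U"
  have Bc: "B \<in> carrier_mat n n" unfolding B_def by (intro mult_carrier_mat[of _ n n] adj_carrier Uc Ac)
  have B_index: "B $$ (i,j) = ip (u i) (A *\<^sub>v u j)" if "i < n" "j < n" for i j
  proof -
    have "B = adj U * (A * U)" unfolding B_def using Uc Ac by (simp add: assoc_mult_mat[of _ n n _ n _ n])
    moreover have "(A * U) $$ (l,j) = (A *\<^sub>v u j) $ l" if "l < n" for l
      using that \<open>j < n\<close> Ac u(2)[OF \<open>j < n\<close>]
      by (subst mult_index_sum, simp_all add: U_def del: index_mult_mat_vec, subst mult_vec_index_sum)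
         auto
    moreover have "(adj U * (A * U)) $$ (i,j) = (\<Sum>l<n. cnj (u i $ l) * (A * U) $$ (l,j))"
      using that Ac Uc by (subst mult_index_sum) (auto simp: U_def simp del: index_mult_mat(1))
    ultimately show ?thesis using u(2)[OF \<open>i < n\<close>] by (simp add: ip_def)
  qed
  \<comment> \<open>Self-adjointness moves \<open>A\<close> onto the eigenvector \<open>u i\<close>,
    leaving a multiple of \<open>ip (u i) (u j)\<close>. So the upper right block vanishes.\<close>
  have B0: "B $$ (i,j) = 0" if "i < k" "k \<le> j" "j < n" for i j
  proof -
    have "B $$ (i,j) = ip (A *\<^sub>v u i) (u j)"
      using that k B_index ip_mult_mat_vec[OF Ac u(2) u(2)] psd_adj[OF A] by simp
    also have "\<dots> = complex_of_real (d i) * ip (u i) (u j)"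
      using that u(1)[of i] ev[of i] by (simp add: ip_smult_left)
    also have "\<dots> = 0"
      using that k u(3) by (simp add: orthonormal_on_def)
    finally show ?thesis .
  qed
  define C where "C = mat (n-k) (n-k) (\<lambda>(i,j). B $$ (i+k,j+k))"
  have Cc: "C \<in> carrier_mat (n-k) (n-k)" by (simp add: C_def)
  obtain l x where "eigenvector C x l"
    using spectrum_non_empty[OF Cc] k by (auto simp: spectrum_def eigenvalue_def)
  then have x: "x \<in> carrier_vec (n-k)" "x \<noteq> 0\<^sub>v (n-k)" "C *\<^sub>v x = l \<cdot>\<^sub>v x"
    using Cc by (auto simp: eigenvector_def)
  \<comment> \<open>Padding with \<open>k\<close> leading zeros lifts an eigenvector of the lower
    block \<open>C\<close> to one of \<open>B\<close>: the first \<open>k\<close> rows give zero by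
    \<open>B0\<close>, the others reproduce \<open>C\<close>.\<close>
  define y where "y = vec n (\<lambda>i. if i < k then 0 else x $ (i-k))"
  have y: "y \<in> carrier_vec n" by (simp add: y_def)
  have y0: "y \<noteq> 0\<^sub>v n"
  proof
    assume "y = 0\<^sub>v n"
    have "x $ i = 0" if "i < n-k" for i
    proof -
      have "y $ (i+k) = 0" unfolding \<open>y = 0\<^sub>v n\<close> using that by simp
      then show ?thesis using that by (simp add: y_def)
    qed
    then show False using x(1,2) by (auto simp: vec_eq_iff)
  qed
  have By: "B *\<^sub>v y = l \<cdot>\<^sub>v y"
  proof (rule eq_vecI)
    fix i assume "i < dim_vec (l \<cdot>\<^sub>v y)"
    then have i: "i < n" using y by simp
    have "(B *\<^sub>v y) $ i = (\<Sum>j<n. B $$ (i,j) * y $ j)"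
      using i Bc y by (subst mult_vec_index_sum) auto
    also have "\<dots> = (\<Sum>j\<in>{k..<n}. B $$ (i,j) * y $ j)"
      using k by (intro sum.mono_neutral_right) (auto simp: y_def)
    also have "\<dots> = (\<Sum>j<n-k. B $$ (i,j+k) * x $ j)"
      using k by (intro sum.reindex_bij_witness[of _ "\<lambda>j. j+k" "\<lambda>j. j-k"]) (auto simp: y_def)
    finally have e: "(B *\<^sub>v y) $ i = (\<Sum>j<n-k. B $$ (i,j+k) * x $ j)" .
    show "(B *\<^sub>v y) $ i = (l \<cdot>\<^sub>v y) $ i"
    proof (cases "i < k")
      case True
      then show ?thesis unfolding e using i by (auto simp: B0 y_def)
    next
      case False
      then have "(\<Sum>j<n-k. B $$ (i,j+k) * x $ j) = (C *\<^sub>v x) $ (i-k)"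
        using i x(1) Cc by (subst mult_vec_index_sum) (auto simp: C_def)
      then show ?thesis unfolding e x(3) using i False x(1) by (auto simp: y_def)
    qed
  qed (use Bc y in auto)
  obtain c where c: "c \<noteq> 0" "ip (c \<cdot>\<^sub>v y) (c \<cdot>\<^sub>v y) = 1"
    using ip_normalized[OF y y0] by blast
  define z where "z = c \<cdot>\<^sub>v y"
  have z: "z \<in> carrier_vec n" using y by (simp add: z_def)
  have Bz: "B *\<^sub>v z = l \<cdot>\<^sub>v z"
    unfolding z_def using By Bc y
    by (simp add: mult_mat_vec[of _ n n] smult_smult_assoc mult.commute)
  define w where "w = U *\<^sub>v z"
  have w: "w \<in> carrier_vec n" using Uc z by (simp add: w_def)
  have Uw: "adj U *\<^sub>v w = z"
    using U Uc z assoc_mult_mat_vec[of "adj U" n n U n z] by (simp add: w_def unitary_def)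
  have Aw: "A *\<^sub>v w = l \<cdot>\<^sub>v w"
  proof -
    have "A *\<^sub>v w = (U * adj U) *\<^sub>v (A *\<^sub>v w)"
      using U Ac w by (simp add: unitary_def)
    also have "\<dots> = U *\<^sub>v (B *\<^sub>v z)"
      unfolding w_def B_def using Uc Ac z by (simp add: assoc_mult_mat_vec[of _ n n _ n] assoc_mult_mat[of _ n n _ n _ n])
    finally show ?thesis using Bz Uc z by (simp add: w_def mult_mat_vec)
  qed
  have ww: "ip w w = 1"
    using c(2) ip_mult_mat_vec[OF Uc w z] Uw by (simp flip: w_def z_def)
  have "ip (v j) w = 0" if "j < k" for j
  proof -
    have jn: "j < n" using that k by simp
    have "z $ j = ip (u j) w"
      using jn Uc w u(2)[OF jn] unfolding Uw[symmetric]
      by (subst mult_vec_index_sum) (auto simp: ip_def U_def)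
    moreover have "z $ j = 0" using that jn by (simp add: z_def y_def)
    ultimately show ?thesis using u(1) that by simp
  qed
  \<comment> \<open>As a Rayleigh quotient of a positive semidefinite matrix, the eigenvalue is real
    and nonnegative.\<close>
  moreover have "l = ip w (A *\<^sub>v w)" using ww by (simp add: Aw ip_smult_right)
  then have "Im l = 0" "Re l \<ge> 0" using psd_ip[OF A w] by auto
  then have "l = complex_of_real (Re l)" by (simp add: complex_eq_iff)
  ultimately show ?thesis using w ww Aw \<open>Re l \<ge> 0\<close> by metis
qed

lemma psd_eigenvectors:
  assumes A: "psd n A" and "k \<le> n"
  shows "\<exists>v d. (\<forall>j<k. v j \<in> carrier_vec n \<and> A *\<^sub>v v j = complex_of_real (d j) \<cdot>\<^sub>v v j) \<and>
    (\<forall>j. d j \<ge> 0) \<and> orthonormal_on {..<k} v"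
  using assms(2)
proof (induction k)
  case 0
  \<comment> \<open>Nonnegativity is claimed for every index, also beyond the range, so that later
    statements can assume it without a bound; hence the default value 0.\<close>
  show ?case by (intro exI[of _ "\<lambda>_. 0\<^sub>v n"] exI[of _ "\<lambda>_. 0"]) (auto simp: orthonormal_on_def)
next
  case (Suc k)
  then obtain v d where v: "\<And>j. j < k \<Longrightarrow> v j \<in> carrier_vec n"
    "\<And>j. j < k \<Longrightarrow> A *\<^sub>v v j = complex_of_real (d j) \<cdot>\<^sub>v v j"
    "\<forall>j. d j \<ge> 0" "orthonormal_on {..<k} v"
    by auto
  obtain w e where w: "w \<in> carrier_vec n" "ip w w = 1" "\<forall>j<k. ip (v j) w = 0"
    "A *\<^sub>v w = complex_of_real e \<cdot>\<^sub>v w" "e \<ge> 0"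
    using psd_new_eigenvector[OF A _ v(1,4,2)] Suc.prems by auto
  have w': "ip w (v j) = 0" if "j < k" for j
    using cnj_ip[of "v j" w] w(1,3) v(1) that by auto
  show ?case
    using v w w' by (intro exI[of _ "v(k := w)"] exI[of _ "d(k := e)"]) (auto simp: orthonormal_on_def less_Suc_eq)
qed

lemma rdiag_carrier [simp]: "rdiag n d \<in> carrier_mat n n"
  by (simp add: rdiag_def)

lemma rdiag_dim [simp]: "dim_row (rdiag n d) = n" "dim_col (rdiag n d) = n"
  by (simp_all add: rdiag_def)

lemma rdiag_index [simp]: "i < n \<Longrightarrow> j < n \<Longrightarrow> rdiag n d $$ (i,j) = (if i = j then complex_of_real (d i) else 0)"
  by (simp add: rdiag_def)

lemma unitary_carrier: "unitary n U \<Longrightarrow> U \<in> carrier_mat n n"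
  by (simp add: unitary_def)

lemma mult_rdiag_index:
  "A \<in> carrier_mat m n \<Longrightarrow> i < m \<Longrightarrow> j < n \<Longrightarrow> (A * rdiag n d) $$ (i,j) = A $$ (i,j) * complex_of_real (d j)"
  by (subst mult_index_sum) (auto simp: if_distrib[of "\<lambda>x. _ * x"] cong: if_cong)

lemma rdiag_mult_index:
  "A \<in> carrier_mat n m \<Longrightarrow> i < n \<Longrightarrow> j < m \<Longrightarrow> (rdiag n d * A) $$ (i,j) = complex_of_real (d i) * A $$ (i,j)"
  by (subst mult_index_sum) (auto simp: if_distrib[of "\<lambda>x. x * _"] cong: if_cong)

theorem psd_spectral:
  assumes A: "psd n A"
  obtains U d where "unitary n U" "\<And>i. d i \<ge> 0" "A = U * rdiag n d * adj U"
proof -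
  obtain v d where v: "\<And>j. j < n \<Longrightarrow> v j \<in> carrier_vec n"
    "\<And>j. j < n \<Longrightarrow> A *\<^sub>v v j = complex_of_real (d j) \<cdot>\<^sub>v v j"
    "\<And>j. d j \<ge> 0" "orthonormal_on {..<n} v"
    using psd_eigenvectors[OF A, of n] by blast
  define U where "U = cols_mat n v"
  have U: "unitary n U" unfolding U_def by (rule unitary_cols_mat) (use v in auto)
  note Uc = unitary_carrier[OF U] and Ac = psd_carrier[OF A]
  \<comment> \<open>Read column by column, this is the family of eigenvector equations.\<close>
  have "A * U = U * rdiag n d"
  proof (rule eq_matI)
    fix i j assume "i < dim_row (U * rdiag n d)" "j < dim_col (U * rdiag n d)"
    then have ij: "i < n" "j < n" using Uc by auto
    have "(A * U) $$ (i,j) = (A *\<^sub>v v j) $ i"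
      using ij Ac Uc v(1)[OF ij(2)]
      by (subst mult_index_sum, simp_all add: U_def del: index_mult_mat_vec, subst mult_vec_index_sum) auto
    also have "\<dots> = complex_of_real (d j) * v j $ i" using v(1,2)[OF ij(2)] ij by simp
    also have "\<dots> = (U * rdiag n d) $$ (i,j)"
      using ij Uc by (simp add: mult_rdiag_index del: index_mult_mat) (simp add: U_def)
    finally show "(A * U) $$ (i,j) = (U * rdiag n d) $$ (i,j)" .
  qed (use Ac Uc in auto)
  then have "A * (U * adj U) = U * rdiag n d * adj U"
    using assoc_mult_mat[of A n n U n "adj U" n] Ac Uc by simp
  then show ?thesis using that[OF U v(3)] U Ac by (simp add: unitary_def)
qed

section \<open>Gram matrices and cancellation of unitaries\<close>

text \<open>The quadratic form at \<open>v\<close> is the squared norm of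
  \<open>M *\<^sub>v v\<close>.\<close>

lemma psd_adj_mult:
  assumes M: "M \<in> carrier_mat m n"
  shows "psd n (adj M * M)"
  unfolding psd_def
proof (intro conjI ballI)
  fix v :: "complex vec" assume v: "v \<in> carrier_vec n"
  have "(\<Sum>i<n. cnj (v $ i) * ((adj M * M) *\<^sub>v v) $ i) = ip v (adj M *\<^sub>v (M *\<^sub>v v))"
    using M v by (simp add: ip_def assoc_mult_mat_vec[of _ n m _ n])
  also have "\<dots> = ip (M *\<^sub>v v) (M *\<^sub>v v)"
    using ip_mult_mat_vec[of "adj M" n m v "M *\<^sub>v v"] M v by simp
  finally show "let q = \<Sum>i<n. cnj (v $ i) * ((adj M * M) *\<^sub>v v) $ i in Im q = 0 \<and> 0 \<le> Re q"
    by (simp add: ip_self Let_def sum_nonneg del: of_real_sum of_real_power)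
qed (use M in auto)

lemma adj_mult_index:
  assumes "M \<in> carrier_mat m n" "N \<in> carrier_mat m l" "i < n" "j < l"
  shows "(adj M * N) $$ (i,j) = (\<Sum>k<m. cnj (M $$ (k,i)) * N $$ (k,j))"
  using assms by (subst mult_index_sum) auto

lemma adj_mult_self_index:
  assumes "M \<in> carrier_mat m n" "i < n"
  shows "(adj M * M) $$ (i,i) = complex_of_real (\<Sum>k<m. (cmod (M $$ (k,i)))\<^sup>2)"
  using assms by (simp add: adj_mult_index[of _ m n _ n] complex_norm_square mult.commute del: of_real_power index_mult_mat)

text \<open>The diagonal of a Gram matrix holds the squared column norms, so all columns
  vanish.\<close>

lemma adj_mult_self_eq_0:
  assumes M: "M \<in> carrier_mat m n" and 0: "adj M * M = 0\<^sub>m n n"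
  shows "M = 0\<^sub>m m n"
proof (rule eq_matI)
  fix i j assume "i < dim_row (0\<^sub>m m n :: complex mat)" "j < dim_col (0\<^sub>m m n :: complex mat)"
  then have ij: "i < m" "j < n" by auto
  have "complex_of_real (\<Sum>k<m. (cmod (M $$ (k,j)))\<^sup>2) = 0"
    using adj_mult_self_index[OF M ij(2)] 0 ij by simp
  then have "(\<Sum>k<m. (cmod (M $$ (k,j)))\<^sup>2) = 0" by (simp only: of_real_eq_0_iff)
  then have "(cmod (M $$ (i,j)))\<^sup>2 = 0"
    using ij by (subst (asm) sum_nonneg_eq_0_iff) auto
  then show "M $$ (i,j) = 0\<^sub>m m n $$ (i,j)" using ij by simp
qed (use M in auto)

lemmas sq_mat_simps =
  assoc_mult_mat[of _ n n _ n _ n] mult_carrier_mat[of _ n n _ n] right_mult_one_mat[of _ n n] for n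

lemma unitary_inverse: "unitary n U \<Longrightarrow> adj U * U = 1\<^sub>m n" "unitary n U \<Longrightarrow> U * adj U = 1\<^sub>m n"
  by (simp_all add: unitary_def)

text \<open>Stated for right-nested products, the form into which \<open>sq_mat_simps\<close>
  rewrites, so that a unitary next to its adjoint cancels inside a longer product.\<close>

lemma unitary_cancel:
  assumes "unitary n U" "X \<in> carrier_mat n m"
  shows "adj U * (U * X) = X" "U * (adj U * X) = X"
proof -
  note U = assms(1)[unfolded unitary_def] and X = assms(2)
  have "adj U * (U * X) = adj U * U * X" using U X by (intro assoc_mult_mat[symmetric]) auto
  also have "\<dots> = X" using U X by (simp del: assoc_mult_mat)
  finally show "adj U * (U * X) = X" .
  have "U * (adj U * X) = U * adj U * X" using U X by (intro assoc_mult_mat[symmetric]) auto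
  also have "\<dots> = X" using U X by (simp del: assoc_mult_mat)
  finally show "U * (adj U * X) = X" .
qed

lemma unitary_adj: "unitary n U \<Longrightarrow> unitary n (adj U)"
  by (auto simp: unitary_def)

lemma unitary_mult:
  assumes "unitary n U" "unitary n V"
  shows "unitary n (U * V)"
proof (rule unitaryI)
  note c = unitary_carrier[OF assms(1)] unitary_carrier[OF assms(2)]
  show "U * V \<in> carrier_mat n n" using c by auto
  show "adj (U * V) * (U * V) = 1\<^sub>m n"
    using c assms unitary_cancel[OF assms(1) c(2)]
    by (simp add: sq_mat_simps[where n = n] unitary_inverse)
qed

lemma adj_rdiag [simp]: "adj (rdiag n d) = rdiag n d"
  by (rule eq_matI) auto

lemma rdiag_mult: "rdiag n d * rdiag n e = rdiag n (\<lambda>i. d i * e i)"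
  by (rule eq_matI) (auto simp: mult_rdiag_index[of _ n n] simp del: index_mult_mat(1))

subsection \<open>Functional calculus and Schatten norms\<close>

text \<open>Entrywise the hypothesis says that \<open>W $$ (i,j)\<close> is zero or
  \<open>d j = e i\<close>; both alternatives survive applying \<open>f\<close>.\<close>

lemma rdiag_intertwine:
  assumes W: "W \<in> carrier_mat n n" and eq: "W * rdiag n d = rdiag n e * W"
  shows "W * rdiag n (\<lambda>i. f (d i)) = rdiag n (\<lambda>i. f (e i)) * W"
proof (rule eq_matI)
  fix i j assume "i < dim_row (rdiag n (\<lambda>i. f (e i)) * W)" "j < dim_col (rdiag n (\<lambda>i. f (e i)) * W)"
  then have ij: "i < n" "j < n" using W by auto
  have "W $$ (i,j) * complex_of_real (d j) = complex_of_real (e i) * W $$ (i,j)"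
    using arg_cong[OF eq, of "\<lambda>M. M $$ (i,j)"]
    by (simp only: mult_rdiag_index[OF W ij] rdiag_mult_index[OF W ij])
  then have "W $$ (i,j) = 0 \<or> d j = e i" by auto
  then show "(W * rdiag n (\<lambda>i. f (d i))) $$ (i,j) = (rdiag n (\<lambda>i. f (e i)) * W) $$ (i,j)"
    unfolding mult_rdiag_index[OF W ij] rdiag_mult_index[OF W ij] by auto
qed (use W in auto)

text \<open>Functional calculus is well defined, even with repeated or permuted eigenvalues:
  \<open>adj V * U\<close> intertwines the two diagonal matrices, hence also their images under
  \<open>f\<close>. This determines the values picked by \<open>THE\<close> in \<open>msqrt\<close>
  and \<open>SOME\<close> in \<open>mat_powr\<close>.\<close>

lemma spectral_fun_unique:
  assumes U: "unitary n U" and V: "unitary n V"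
    and eq: "U * rdiag n d * adj U = V * rdiag n e * adj V"
  shows "U * rdiag n (\<lambda>i. f (d i)) * adj U = V * rdiag n (\<lambda>i. f (e i)) * adj V"
proof -
  note [simp] = unitary_carrier[OF U] unitary_carrier[OF V]
    sq_mat_simps[where n = n] unitary_inverse[OF U]
    unitary_cancel[OF U, of _ n] unitary_cancel[OF V, of _ n]
  define W where "W = adj V * U"
  have [simp]: "W \<in> carrier_mat n n" by (simp add: W_def)
  have "W * rdiag n d = adj V * (U * rdiag n d * adj U) * U"
    by (simp add: W_def)
  also have "\<dots> = rdiag n e * W" unfolding eq by (simp add: W_def)
  finally have W: "W * rdiag n (\<lambda>i. f (d i)) = rdiag n (\<lambda>i. f (e i)) * W"
    by (rule rdiag_intertwine[of W n d e f, rotated]) simp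
  have "U * rdiag n (\<lambda>i. f (d i)) * adj U = V * (W * rdiag n (\<lambda>i. f (d i))) * adj U"
    by (simp add: W_def)
  also have "\<dots> = V * rdiag n (\<lambda>i. f (e i)) * adj V"
    unfolding W by (simp add: W_def)
  finally show ?thesis .
qed

lemma spectral_mult:
  assumes U: "unitary n U"
  shows "(U * rdiag n d * adj U) * (U * rdiag n e * adj U) = U * rdiag n (\<lambda>i. d i * e i) * adj U"
  using unitary_carrier[OF U] unitary_cancel[OF U, of _ n]
  by (simp add: sq_mat_simps[where n = n] flip: rdiag_mult)

lemma spectral_adj:
  assumes "U \<in> carrier_mat n n" "V \<in> carrier_mat n n"
  shows "adj (U * rdiag n d * adj V) = V * rdiag n d * adj U"
  using assms by (simp add: sq_mat_simps[where n = n])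

lemma psd_spectralI:
  assumes U: "unitary n U" and d: "\<And>i. d i \<ge> 0"
  shows "psd n (U * rdiag n d * adj U)"
proof -
  note Uc = unitary_carrier[OF U]
  let ?M = "U * rdiag n (\<lambda>i. sqrt (d i)) * adj U"
  have "adj ?M * ?M = U * rdiag n d * adj U"
    unfolding spectral_adj[OF Uc Uc] spectral_mult[OF U] by (simp add: d)
  then show ?thesis using psd_adj_mult[of ?M n n] Uc by (simp add: mult_carrier_mat[of _ n n _ n])
qed

lemma msqrt_spectral:
  assumes U: "unitary n U" and d: "\<And>i. d i \<ge> 0"
  shows "msqrt (U * rdiag n d * adj U) = U * rdiag n (\<lambda>i. sqrt (d i)) * adj U"
proof -
  have dim: "dim_row (U * rdiag n d * adj U) = n" using unitary_carrier[OF U] by simp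
  show ?thesis unfolding msqrt_def dim
  proof (rule the_equality)
    show "psd n (U * rdiag n (\<lambda>i. sqrt (d i)) * adj U) \<and>
      U * rdiag n (\<lambda>i. sqrt (d i)) * adj U * (U * rdiag n (\<lambda>i. sqrt (d i)) * adj U) = U * rdiag n d * adj U"
      using psd_spectralI[OF U, of "\<lambda>i. sqrt (d i)"] d by (simp add: spectral_mult[OF U])
  next
    fix B assume B: "psd n B \<and> B * B = U * rdiag n d * adj U"
    then obtain V b where V: "unitary n V" and b: "\<And>i. b i \<ge> 0" and Bb: "B = V * rdiag n b * adj V"
      using psd_spectral by blast
    \<comment> \<open>Any competing root \<open>B\<close> is diagonalized first. Applying
      \<open>sqrt\<close> to both decompositions of \<open>B * B\<close> recovers \<open>B\<close>,
      because its eigenvalues are nonnegative.\<close>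
    have "V * rdiag n (\<lambda>i. b i * b i) * adj V = U * rdiag n d * adj U"
      using B unfolding Bb spectral_mult[OF V] by simp
    from spectral_fun_unique[OF V U this, of sqrt] b
    show "B = U * rdiag n (\<lambda>i. sqrt (d i)) * adj U" by (simp add: Bb)
  qed
qed

lemma mat_powr_spectral:
  assumes U: "unitary n U" and d: "\<And>i. d i \<ge> 0"
  shows "mat_powr (U * rdiag n d * adj U) r = U * rdiag n (\<lambda>i. d i powr r) * adj U"
proof -
  have dim: "dim_row (U * rdiag n d * adj U) = n" using unitary_carrier[OF U] by simp
  show ?thesis unfolding mat_powr_def dim
  proof (rule some_equality)
    show "\<exists>V e. unitary n V \<and> (\<forall>i. 0 \<le> e i) \<and>
       U * rdiag n d * adj U = V * rdiag n e * adj V \<and>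
       U * rdiag n (\<lambda>i. d i powr r) * adj U = V * rdiag n (\<lambda>i. e i powr r) * adj V"
      using U d by blast
  next
    fix B assume "\<exists>V e. unitary n V \<and> (\<forall>i. 0 \<le> e i) \<and>
       U * rdiag n d * adj U = V * rdiag n e * adj V \<and>
       B = V * rdiag n (\<lambda>i. e i powr r) * adj V"
    then obtain V e where "unitary n V" "U * rdiag n d * adj U = V * rdiag n e * adj V"
      "B = V * rdiag n (\<lambda>i. e i powr r) * adj V" by blast
    then show "B = U * rdiag n (\<lambda>i. d i powr r) * adj U"
      using spectral_fun_unique[OF U, of V d e "\<lambda>x. x powr r"] by simp
  qed
qed

section \<open>Traces, Schatten norms and singular values\<close>

lemma tr_mult_comm:
  assumes "A \<in> carrier_mat n m" "B \<in> carrier_mat m n"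
  shows "tr (A * B) = tr (B * A)"
proof -
  have "tr (A * B) = (\<Sum>i<n. \<Sum>j<m. A $$ (i,j) * B $$ (j,i))"
    using assms by (auto simp: tr_def mult_index_sum simp del: index_mult_mat(1))
  also have "\<dots> = (\<Sum>j<m. \<Sum>i<n. A $$ (i,j) * B $$ (j,i))" by (rule sum.swap)
  also have "\<dots> = tr (B * A)"
    using assms by (auto simp: tr_def mult_index_sum mult.commute simp del: index_mult_mat(1))
  finally show ?thesis .
qed

lemma tr_unitary_conj:
  assumes U: "unitary n U" and X: "X \<in> carrier_mat n n"
  shows "tr (U * X * adj U) = tr X"
  using tr_mult_comm[of "U * X" n n "adj U"] unitary_carrier[OF U] X unitary_cancel[OF U X]
  by (simp add: mult_carrier_mat[of _ n n _ n])

lemma tr_rdiag: "tr (rdiag n d) = complex_of_real (\<Sum>i<n. d i)"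
  by (simp add: tr_def)

lemma schatten_spectral:
  assumes U: "unitary n U" and d: "\<And>i. d i \<ge> 0" and A: "A * adj A = U * rdiag n d * adj U"
  shows "schatten p A = (\<Sum>i<n. d i powr (p / 2)) powr (1 / p)"
  by (simp add: schatten_def A mat_powr_spectral[OF U d] tr_unitary_conj[OF U] tr_rdiag del: of_real_sum)

text \<open>The eigenvalues of \<open>A * adj A\<close> are the squares of the \<open>s i\<close>,
  and the exponent \<open>p / 2\<close> undoes the square. With \<open>U = V\<close> it gives the
  norm of a positive semidefinite matrix from its spectrum.\<close>

lemma schatten_svd:
  assumes U: "unitary n U" and V: "unitary n V" and s: "\<And>i. s i \<ge> 0"
  shows "schatten p (U * rdiag n s * adj V) = (\<Sum>i<n. s i powr p) powr (1 / p)"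
proof -
  note c = unitary_carrier[OF U] unitary_carrier[OF V]
  have "U * rdiag n s * adj V * adj (U * rdiag n s * adj V) = U * rdiag n (\<lambda>i. s i * s i) * adj U"
    unfolding spectral_adj[OF c] using c unitary_cancel[OF V, of _ n]
    by (simp add: sq_mat_simps[where n = n] flip: rdiag_mult)
  from schatten_spectral[OF U _ this, of p]
  have "schatten p (U * rdiag n s * adj V) = (\<Sum>i<n. (s i * s i) powr (p / 2)) powr (1 / p)"
    by simp
  also have "(\<lambda>i. (s i * s i) powr (p / 2)) = (\<lambda>i. s i powr p)"
    by (simp add: powr_mult s flip: powr_add)
  finally show ?thesis .
qed

text \<open>If \<open>U\<close> diagonalizes \<open>A * adj A\<close>, the columns of
  \<open>adj A * U\<close> are orthogonal with squared norms \<open>d\<close>. Normalizing the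
  nonzero ones and completing them to a basis gives \<open>V\<close>.\<close>

lemma svd:
  assumes A: "A \<in> carrier_mat n n"
  obtains U V s where "unitary n U" "unitary n V" "\<And>i. s i \<ge> 0" "A = U * rdiag n s * adj V"
proof -
  have "psd n (A * adj A)" using psd_adj_mult[of "adj A" n n] A by simp
  then obtain U d where U: "unitary n U" and d: "\<And>i. d i \<ge> 0" and AA: "A * adj A = U * rdiag n d * adj U"
    using psd_spectral by blast
  note Uc = unitary_carrier[OF U]
  define B where "B = adj A * U"
  have B: "B \<in> carrier_mat n n" using A Uc by (simp add: B_def mult_carrier_mat[of _ n n _ n])
  have "adj B * B = adj U * (A * adj A) * U"
    using A Uc by (simp add: B_def sq_mat_simps[where n = n])
  also have "\<dots> = rdiag n d" unfolding AA
    using Uc U unitary_cancel[OF U, of _ n]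
    by (simp add: sq_mat_simps[where n = n] unitary_inverse)
  finally have BB: "adj B * B = rdiag n d" .
  have col: "ip (col B i) (col B j) = (if i = j then complex_of_real (d i) else 0)" if "i < n" "j < n" for i j
    using that B adj_mult_index[OF B B that] unfolding BB by (simp add: ip_def)
  \<comment> \<open>Only columns of positive norm can be normalized. The others are zero, so any
    completion serves there.\<close>
  define K where "K = {k. k < n \<and> d k > 0}"
  define w where "w k = complex_of_real (1 / sqrt (d k)) \<cdot>\<^sub>v col B k" for k
  have "orthonormal_on K w"
    unfolding orthonormal_on_def
    by (auto simp: K_def w_def ip_smult_left ip_smult_right col simp flip: of_real_mult)
  moreover have "K \<subseteq> {..<n}" "\<And>k. k \<in> K \<Longrightarrow> w k \<in> carrier_vec n"
    using B by (auto simp: K_def w_def)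
  ultimately obtain v where v: "\<And>k. k \<in> K \<Longrightarrow> v k = w k" "\<And>k. k < n \<Longrightarrow> v k \<in> carrier_vec n" "orthonormal_on {..<n} v"
    using orthonormal_completion[of K n w] by blast
  define V where "V = cols_mat n v"
  have V: "unitary n V" unfolding V_def by (rule unitary_cols_mat) (use v in auto)
  note Vc = unitary_carrier[OF V]
  have "B = V * rdiag n (\<lambda>i. sqrt (d i))"
  proof (rule eq_matI)
    fix i j assume "i < dim_row (V * rdiag n (\<lambda>i. sqrt (d i)))" "j < dim_col (V * rdiag n (\<lambda>i. sqrt (d i)))"
    then have ij: "i < n" "j < n" using Vc by auto
    show "B $$ (i,j) = (V * rdiag n (\<lambda>i. sqrt (d i))) $$ (i,j)"
    proof (cases "d j > 0")
      case True
      then have "v j = w j" using v(1) ij by (simp add: K_def)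
      then show ?thesis unfolding mult_rdiag_index[OF Vc ij]
        using ij B True by (simp add: V_def w_def)
    next
      case False
      then have dj: "d j = 0" using d[of j] by simp
      have "complex_of_real (\<Sum>k<n. (cmod (B $$ (k,j)))\<^sup>2) = 0"
        using adj_mult_self_index[OF B ij(2)] ij dj by (simp add: BB)
      then have "(\<Sum>k<n. (cmod (B $$ (k,j)))\<^sup>2) = 0" by (simp only: of_real_eq_0_iff)
      then have "(cmod (B $$ (i,j)))\<^sup>2 = 0"
        using ij by (subst (asm) sum_nonneg_eq_0_iff) auto
      then show ?thesis unfolding mult_rdiag_index[OF Vc ij] using dj by simp
    qed
  qed (use B Vc in auto)
  then have "adj A = V * rdiag n (\<lambda>i. sqrt (d i)) * adj U"
    using U Uc A assoc_mult_mat[of "adj A" n n U n "adj U" n] by (simp add: B_def unitary_def)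
  then have "A = U * rdiag n (\<lambda>i. sqrt (d i)) * adj V"
    using spectral_adj[OF Vc Uc] by (metis adj_adj)
  then show ?thesis using that[OF U V, of "\<lambda>i. sqrt (d i)"] d by simp
qed

subsection \<open>Hoelder inequality for Schatten norms, with equality case\<close>

text \<open>The endpoint 0 is treated apart: if one argument is 0, the claim reduces to
  \<open>(c * y) powr p \<le> c * y powr p\<close>, which holds because
  \<open>c powr p \<le> c\<close> for \<open>c\<close> between 0 and 1.\<close>

lemma convex_on_powr: 
  assumes "p \<ge> 1"
  shows "convex_on {0..} (\<lambda>x::real. x powr p)"
proof (rule convex_onI)
  have le: "(c * y) powr p \<le> c * y powr p" if "0 < c" "c < 1" "y \<ge> 0" for c y :: real
  proof -
    have "(c * y) powr p = c powr p * y powr p" using that by (simp add: powr_mult)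
    moreover have "c powr p \<le> c powr 1" using that assms by (intro powr_mono') auto
    ultimately show ?thesis using that by (simp add: mult_right_mono)
  qed
  fix t x y :: real assume t: "0 < t" "t < 1" and x: "x \<in> {0..}" and y: "y \<in> {0..}"
  show "((1 - t) *\<^sub>R x + t *\<^sub>R y) powr p \<le> (1 - t) * x powr p + t * y powr p"
  proof (cases "x = 0 \<or> y = 0")
    case True
    then show ?thesis using t x y le[of t y] le[of "1 - t" x] by auto
  next
    case False
    then show ?thesis using t x y convex_onD[OF powr_convex[OF assms], of t x y] by auto
  qed
qed simp

lemma unitary_sum_col:
  assumes W: "unitary n W" and k: "k < n"
  shows "(\<Sum>i<n. (cmod (W $$ (i,k)))\<^sup>2) = 1"
proof -
  have "complex_of_real (\<Sum>i<n. (cmod (W $$ (i,k)))\<^sup>2) = 1"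
    using adj_mult_self_index[OF unitary_carrier[OF W] k] W k by (simp add: unitary_def)
  then show ?thesis by (simp only: of_real_eq_1_iff)
qed

lemma unitary_sum_row:
  assumes W: "unitary n W" and i: "i < n"
  shows "(\<Sum>k<n. (cmod (W $$ (i,k)))\<^sup>2) = 1"
  using unitary_sum_col[OF unitary_adj[OF W] i] i unitary_carrier[OF W] by simp

text \<open>The squared moduli of \<open>W\<close> form a doubly stochastic matrix: unit column sums
  permit Jensen for each \<open>k\<close>, and unit row sums collapse the double sum.\<close>

lemma unitary_jensen:
  assumes W: "unitary n W" and d: "\<And>i. d i \<ge> 0" and p: "p \<ge> 1"
  shows "(\<Sum>k<n. (\<Sum>i<n. (cmod (W $$ (i,k)))\<^sup>2 * d i) powr p) \<le> (\<Sum>i<n. d i powr p)"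
proof -
  have "(\<Sum>i<n. (cmod (W $$ (i,k)))\<^sup>2 * d i) powr p \<le> (\<Sum>i<n. (cmod (W $$ (i,k)))\<^sup>2 * d i powr p)"
    if "k < n" for k
    using convex_on_sum[OF _ _ convex_on_powr[OF p] unitary_sum_col[OF W that], of d] d that by auto
  then have "(\<Sum>k<n. (\<Sum>i<n. (cmod (W $$ (i,k)))\<^sup>2 * d i) powr p)
      \<le> (\<Sum>k<n. \<Sum>i<n. (cmod (W $$ (i,k)))\<^sup>2 * d i powr p)"
    by (intro sum_mono) auto
  also have "\<dots> = (\<Sum>i<n. (\<Sum>k<n. (cmod (W $$ (i,k)))\<^sup>2) * d i powr p)"
    unfolding sum_distrib_right by (rule sum.swap)
  also have "\<dots> = (\<Sum>i<n. d i powr p)" by (simp add: unitary_sum_row[OF W])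
  finally show ?thesis .
qed

text \<open>The squared column norms of \<open>R * U\<close> are the diagonal of
  \<open>adj W * rdiag n d * W\<close> with \<open>W = adj E * U\<close>, that is, means of
  \<open>d\<close> weighted by the squared moduli in a column of \<open>W\<close>.\<close>

lemma sum_powr_col_norms_le:
  assumes E: "unitary n E" and U: "unitary n U" and d: "\<And>i. d i \<ge> 0" and p: "p \<ge> 1"
    and R: "R \<in> carrier_mat n n" "adj R * R = E * rdiag n d * adj E"
  shows "(\<Sum>k<n. (\<Sum>i<n. (cmod ((R * U) $$ (i,k)))\<^sup>2) powr p) \<le> (\<Sum>i<n. d i powr p)"
proof -
  note c = unitary_carrier[OF E] unitary_carrier[OF U]
  define W where "W = adj E * U"
  have W: "unitary n W" unfolding W_def by (intro unitary_mult unitary_adj E U)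
  note Wc = unitary_carrier[OF W]
  have RU: "R * U \<in> carrier_mat n n" using R c by (simp add: mult_carrier_mat[of _ n n _ n])
  have "adj (R * U) * (R * U) = adj U * (adj R * R) * U"
    using R(1) c by (simp add: sq_mat_simps[where n = n])
  also have "\<dots> = adj W * (rdiag n d * W)"
    unfolding R(2) W_def using c by (simp add: sq_mat_simps[where n = n])
  finally have eq: "adj (R * U) * (R * U) = adj W * (rdiag n d * W)" .
  have "(\<Sum>i<n. (cmod ((R * U) $$ (i,k)))\<^sup>2) = (\<Sum>i<n. (cmod (W $$ (i,k)))\<^sup>2 * d i)" if k: "k < n" for k
  proof -
    have "complex_of_real (\<Sum>i<n. (cmod ((R * U) $$ (i,k)))\<^sup>2) = (adj W * (rdiag n d * W)) $$ (k,k)"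
      unfolding adj_mult_self_index[OF RU k, symmetric] eq ..
    also have "\<dots> = (\<Sum>i<n. cnj (W $$ (i,k)) * (complex_of_real (d i) * W $$ (i,k)))"
      using adj_mult_index[OF Wc mult_carrier_mat[OF rdiag_carrier Wc] k k, of d] k
      by (auto simp: rdiag_mult_index[OF Wc] simp del: index_mult_mat(1) intro!: sum.cong)
    also have "\<dots> = complex_of_real (\<Sum>i<n. (cmod (W $$ (i,k)))\<^sup>2 * d i)"
      by (simp add: complex_norm_square mult_ac del: of_real_power)
    finally show ?thesis by (simp only: of_real_eq_iff)
  qed
  then show ?thesis using unitary_jensen[OF W d p] by simp
qed

text \<open>Since \<open>adj (R * U) * (S * V) = rdiag n s\<close>, the number \<open>s k\<close> is
  the inner product of the two \<open>k\<close>-th columns. Expand the squared norm of their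
  difference.\<close>

lemma singular_value_polarization:
  assumes U: "unitary n U" and V: "unitary n V" and RS: "R \<in> carrier_mat n n" "S \<in> carrier_mat n n"
    and svd: "adj R * S = U * rdiag n s * adj V" and k: "k < n"
  shows "(\<Sum>i<n. (cmod ((R * U) $$ (i,k)))\<^sup>2) + (\<Sum>i<n. (cmod ((S * V) $$ (i,k)))\<^sup>2) - 2 * s k
    = (\<Sum>i<n. (cmod ((R * U) $$ (i,k) - (S * V) $$ (i,k)))\<^sup>2)"
proof -
  note c = unitary_carrier[OF U] unitary_carrier[OF V] RS
  define M N where "M = R * U" and "N = S * V"
  have MN: "M \<in> carrier_mat n n" "N \<in> carrier_mat n n"
    using c by (auto simp: M_def N_def)
  have "adj M * N = adj U * (adj R * S) * V"
    using c by (simp add: M_def N_def sq_mat_simps[where n = n])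
  also have "\<dots> = rdiag n s"
    unfolding svd using c U V unitary_cancel[OF U, of _ n]
    by (simp add: sq_mat_simps[where n = n] unitary_inverse)
  finally have "(\<Sum>i<n. cnj (M $$ (i,k)) * N $$ (i,k)) = complex_of_real (s k)"
    using adj_mult_index[OF MN k k] k by simp
  then have "s k = (\<Sum>i<n. Re (cnj (M $$ (i,k)) * N $$ (i,k)))"
    by (metis Re_complex_of_real Re_sum)
  moreover have "(cmod (a - b))\<^sup>2 = (cmod a)\<^sup>2 + (cmod b)\<^sup>2 - 2 * Re (cnj a * b)" for a b
    unfolding cmod_power2 by (simp add: power2_eq_square algebra_simps)
  ultimately show ?thesis
    unfolding M_def[symmetric] N_def[symmetric]
    by (simp add: sum.distrib sum_subtractf sum_distrib_left)
qed

lemma schatten_holder: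
  assumes E: "unitary n E" and G: "unitary n G" and U: "unitary n U" and V: "unitary n V"
    and nn: "\<And>i. l i \<ge> 0" "\<And>i. m i \<ge> 0" "\<And>i. s i \<ge> 0" and p: "p \<ge> 1"
    and R: "R \<in> carrier_mat n n" "adj R * R = E * rdiag n l * adj E"
    and S: "S \<in> carrier_mat n n" "adj S * S = G * rdiag n m * adj G"
    and svd: "adj R * S = U * rdiag n s * adj V"
  defines "x \<equiv> \<Sum>i<n. s i powr p" and "y \<equiv> \<Sum>i<n. l i powr p" and "z \<equiv> \<Sum>i<n. m i powr p"
  shows "x \<le> max y z" and "x = max y z \<Longrightarrow> R * U = S * V"
proof -
  define a b where "a k = (\<Sum>i<n. (cmod ((R * U) $$ (i,k)))\<^sup>2)" 
    and "b k = (\<Sum>i<n. (cmod ((S * V) $$ (i,k)))\<^sup>2)" for k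
  have ab: "a k \<ge> 0" "b k \<ge> 0" for k by (auto simp: a_def b_def sum_nonneg)
  have pol: "a k + b k - 2 * s k = (\<Sum>i<n. (cmod ((R * U) $$ (i,k) - (S * V) $$ (i,k)))\<^sup>2)" if "k < n" for k
    unfolding a_def b_def by (rule singular_value_polarization[OF U V R(1) S(1) svd that])
  have s_le: "s k \<le> (a k + b k) / 2" if "k < n" for k
  proof -
    have "a k + b k - 2 * s k \<ge> 0" unfolding pol[OF that] by (intro sum_nonneg) auto
    then show ?thesis by simp
  qed
  have term_le: "s k powr p \<le> ((a k + b k) / 2) powr p" if "k < n" for k
    using s_le[OF that] nn p by (intro powr_mono2) auto
  have 1: "x \<le> (\<Sum>k<n. ((a k + b k) / 2) powr p)"
    unfolding x_def using term_le by (intro sum_mono) auto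
  have "((a k + b k) / 2) powr p \<le> (a k powr p + b k powr p) / 2" for k
    using convex_onD[OF convex_on_powr[OF p], of "1/2" "a k" "b k"] ab by (simp add: field_simps)
  then have "(\<Sum>k<n. ((a k + b k) / 2) powr p) \<le> (\<Sum>k<n. (a k powr p + b k powr p) / 2)"
    by (intro sum_mono) auto
  also have "\<dots> = ((\<Sum>k<n. a k powr p) + (\<Sum>k<n. b k powr p)) / 2"
    by (simp add: sum.distrib flip: sum_divide_distrib)
  also have "\<dots> \<le> (y + z) / 2"
    using sum_powr_col_norms_le[OF E U nn(1) p R] sum_powr_col_norms_le[OF G V nn(2) p S]
    by (simp add: a_def b_def y_def z_def)
  also have "\<dots> \<le> max y z" by (simp add: max_def)
  finally have 2: "(\<Sum>k<n. ((a k + b k) / 2) powr p) \<le> max y z" .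
  show "x \<le> max y z" using 1 2 by linarith
  assume "x = max y z"
  \<comment> \<open>Equality of the two ends makes the first inequality of the chain tight.\<close>
  then have eq: "(\<Sum>k<n. s k powr p) = (\<Sum>k<n. ((a k + b k) / 2) powr p)"
    using 1 2 unfolding x_def by (metis order.antisym)
  show "R * U = S * V"
  proof (rule eq_matI)
    fix i k assume "i < dim_row (S * V)" "k < dim_col (S * V)"
    then have ik: "i < n" "k < n" using S(1) unitary_carrier[OF V] by auto
    \<comment> \<open>Equal sums of ordered terms have equal terms. Strict monotonicity of the
      power, valid already for \<open>p = 1\<close>, then gives
      \<open>s k = (a k + b k) / 2\<close>, and polarization makes the columns equal.\<close>
    have "s k powr p = ((a k + b k) / 2) powr p"
      using sum_mono_inv[OF eq term_le] ik by simp
    then have "s k = (a k + b k) / 2"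
      using powr_less_mono2[of p "s k" "(a k + b k) / 2"] s_le[OF ik(2)] nn(3)[of k] p by fastforce
    then have "(\<Sum>i<n. (cmod ((R * U) $$ (i,k) - (S * V) $$ (i,k)))\<^sup>2) = 0"
      using pol[OF ik(2)] by simp
    then have "(cmod ((R * U) $$ (i,k) - (S * V) $$ (i,k)))\<^sup>2 = 0"
      using ik by (subst (asm) sum_nonneg_eq_0_iff) auto
    then show "(R * U) $$ (i,k) = (S * V) $$ (i,k)" by simp
  qed (use R S unitary_carrier[OF U] unitary_carrier[OF V] in auto)
qed

subsection \<open>The fidelity\<close>

lemma density_spectral:
  assumes "density n \<rho>"
  obtains E d where "unitary n E" "\<And>i. d i \<ge> 0" "\<rho> = E * rdiag n d * adj E" "(\<Sum>i<n. d i) = 1"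
proof -
  obtain E d where E: "unitary n E" and d: "\<And>i. d i \<ge> 0" and \<rho>: "\<rho> = E * rdiag n d * adj E"
    using assms psd_spectral unfolding density_def by blast
  have "complex_of_real (\<Sum>i<n. d i) = 1"
    using assms tr_unitary_conj[OF E, of "rdiag n d"] by (simp add: density_def \<rho> tr_rdiag)
  then have "(\<Sum>i<n. d i) = 1" by (simp only: of_real_eq_1_iff)
  then show ?thesis using that E d \<rho> by blast
qed

text \<open>Keeps the denominator of the fidelity away from zero.\<close>

lemma sum_powr_pos:
  assumes "\<And>i. d i \<ge> (0::real)" "(\<Sum>i<n. d i) = 1"
  shows "(\<Sum>i<(n::nat). d i powr p) > 0"
proof -
  have "\<exists>i<n. d i \<noteq> 0" using assms(2) by (metis lessThan_iff sum.neutral zero_neq_one)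
  then obtain i where "i < n" "d i > 0" using assms(1) by (metis less_eq_real_def)
  then show ?thesis by (intro sum_pos2[of _ i]) auto
qed

text \<open>Reduces the fidelity to a formula in the spectra and singular values, from which every
  property except the pure-state one is derived.\<close>

lemma Fp_spectral:
  assumes E: "unitary n E" and G: "unitary n G" and U: "unitary n U" and V: "unitary n V"
    and nn: "\<And>i. l i \<ge> 0" "\<And>i. m i \<ge> 0" "\<And>i. s i \<ge> 0" and p: "p > 0"
    and \<rho>: "\<rho> = E * rdiag n l * adj E" and \<sigma>: "\<sigma> = G * rdiag n m * adj G"
    and svd: "msqrt \<rho> * msqrt \<sigma> = U * rdiag n s * adj V"
  shows "Fp p \<rho> \<sigma> = ((\<Sum>i<n. s i powr p) / max (\<Sum>i<n. l i powr p) (\<Sum>i<n. m i powr p)) powr (2 / p)"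
proof -
  have sq: "(x powr (1 / p))\<^sup>2 = x powr (2 / p)" for x :: real
    by (simp add: power2_eq_square flip: powr_add)
  \<comment> \<open>Monotonicity of the outer power lets it leave the maximum; the arguments swap
    because \<open>Fp\<close> lists the norm of \<open>\<sigma>\<close> first.\<close>
  have mx: "max (x powr (2 / p)) (y powr (2 / p)) = max y x powr (2 / p)" if "x \<ge> 0" "y \<ge> 0" for x y :: real
    using that p powr_mono2[of "2 / p" x y] powr_mono2[of "2 / p" y x] by (auto simp: max_def)
  show ?thesis
    unfolding Fp_def svd schatten_svd[OF U V nn(3)]
    unfolding \<rho> \<sigma> schatten_svd[OF E E nn(1)] schatten_svd[OF G G nn(2)] sq
    by (simp add: mx sum_nonneg powr_divide)
qed

text \<open>A rank-one projector is its own square root, and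
  \<open>\<rho> * \<sigma> * \<rho>\<close> is \<open>\<rho>\<close> scaled by
  \<open>c = tr (\<rho> * \<sigma>)\<close>. So the numerator is \<open>c\<close> for every
  \<open>p\<close>, while the denominator is 1 as \<open>\<rho>\<close> has norm 1 and
  \<open>\<sigma>\<close> at most 1.\<close>

lemma Fp_pure_state:
  assumes pure: "pure_state n \<rho>" and \<sigma>: "density n \<sigma>" and p: "p \<ge> 1"
  shows "complex_of_real (Fp p \<rho> \<sigma>) = tr (\<rho> * \<sigma>)"
proof -
  obtain v where v: "v \<in> carrier_vec n" "(\<Sum>i<n. (cmod (v $ i))\<^sup>2) = 1"
    and \<rho>: "\<rho> = mat n n (\<lambda>(i,j). v $ i * cnj (v $ j))"
    using pure by (auto simp: pure_state_def)
  have n: "n > 0" using v(2) by (cases n) auto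
  have "ip v v = 1" using v by (simp add: ip_self del: of_real_sum of_real_power)
  then obtain u where u: "u 0 = v" "\<And>k. k < n \<Longrightarrow> u k \<in> carrier_vec n" "orthonormal_on {..<n} u"
    using orthonormal_completion[of "{0}" n "\<lambda>_. v"] n v by (auto simp: orthonormal_on_def)
  define E where "E = cols_mat n u"
  \<comment> \<open>A spectrum concentrated at index 0, the position of \<open>v\<close> in the
    basis: \<open>l 1\<close> belongs to \<open>\<rho>\<close> and \<open>l c\<close> to
    \<open>\<rho> * \<sigma> * \<rho>\<close>.\<close>
  define l :: "real \<Rightarrow> nat \<Rightarrow> real" where "l c i = (if i = 0 then c else 0)" for c i
  have E: "unitary n E" unfolding E_def by (rule unitary_cols_mat) (use u in auto)
  note Ec = unitary_carrier[OF E]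
  have \<rho>E: "\<rho> = E * rdiag n (l 1) * adj E"
  proof (rule eq_matI)
    fix i j assume "i < dim_row (E * rdiag n (l 1) * adj E)" "j < dim_col (E * rdiag n (l 1) * adj E)"
    then have ij: "i < n" "j < n" using Ec by auto
    have "(E * rdiag n (l 1) * adj E) $$ (i,j) = (\<Sum>k<n. E $$ (i,k) * complex_of_real (l 1 k) * cnj (E $$ (j,k)))"
      using ij Ec by (subst mult_index_sum) (auto simp: mult_rdiag_index[of _ n n] simp del: index_mult_mat(1))
    also have "\<dots> = (\<Sum>k\<in>{0}. E $$ (i,k) * complex_of_real (l 1 k) * cnj (E $$ (j,k)))"
      using n by (intro sum.mono_neutral_right) (auto simp: l_def)
    finally show "\<rho> $$ (i,j) = (E * rdiag n (l 1) * adj E) $$ (i,j)"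
      using ij n by (simp add: \<rho> l_def E_def u(1) del: index_mult_mat(1))
  qed (use Ec \<rho> in auto)
  obtain G m where G: "unitary n G" and m: "\<And>i. m i \<ge> 0" and \<sigma>G: "\<sigma> = G * rdiag n m * adj G"
    and m1: "(\<Sum>i<n. m i) = 1"
    using density_spectral[OF \<sigma>] by blast
  note Gc = unitary_carrier[OF G]
  define S where "S = msqrt \<sigma>"
  have S: "S = G * rdiag n (\<lambda>i. sqrt (m i)) * adj G" unfolding S_def \<sigma>G by (rule msqrt_spectral[OF G m])
  have Sc: "S \<in> carrier_mat n n" unfolding S using Gc by (auto simp: mult_carrier_mat[of _ n n _ n])
  have Sa: "adj S = S" unfolding S by (rule spectral_adj[OF Gc Gc])
  have SS: "S * S = \<sigma>" unfolding S spectral_mult[OF G] \<sigma>G by (simp add: m)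
  have "(\<lambda>i. sqrt (l 1 i)) = l 1" "l 1 i \<ge> 0" for i by (auto simp: l_def)
  then have R: "msqrt \<rho> = \<rho>"
    unfolding \<rho>E using msqrt_spectral[OF E, of "l 1"] by simp
  \<comment> \<open>This is \<open>\<sigma>\<close> in the basis \<open>E\<close>. Writing it as a
    Gram matrix exhibits its corner entry as a nonnegative real \<open>c\<close>.\<close>
  define X where "X = adj (S * E) * (S * E)"
  have SE: "S * E \<in> carrier_mat n n" using Sc Ec by auto
  have Xc: "X \<in> carrier_mat n n" unfolding X_def by (rule mult_carrier_mat[OF adj_carrier[OF SE] SE])
  define c where "c = (\<Sum>k<n. (cmod ((S * E) $$ (k,0)))\<^sup>2)"
  have c0: "c \<ge> 0" unfolding c_def by (intro sum_nonneg) auto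
  have X00: "X $$ (0,0) = complex_of_real c"
    unfolding X_def c_def by (rule adj_mult_self_index[OF SE n])
  have XE: "X = adj E * \<sigma> * E"
    unfolding X_def SS[symmetric] using Sc Ec Sa
    by (simp add: sq_mat_simps[where n = n])
  have DX: "rdiag n (l 1) * X * rdiag n (l 1) = rdiag n (l c)"
  proof (rule eq_matI)
    fix i j assume "i < dim_row (rdiag n (l c))" "j < dim_col (rdiag n (l c))"
    then have ij: "i < n" "j < n" by auto
    have "rdiag n (l 1) * X \<in> carrier_mat n n" using Xc by auto
    then show "(rdiag n (l 1) * X * rdiag n (l 1)) $$ (i,j) = rdiag n (l c) $$ (i,j)"
      using ij X00 by (simp add: mult_rdiag_index[of _ n n] rdiag_mult_index[OF Xc] l_def del: index_mult_mat(1))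
  qed auto
  have \<sigma>c: "\<sigma> \<in> carrier_mat n n" using Gc by (simp add: \<sigma>G mult_carrier_mat[of _ n n _ n])
  have \<rho>c: "\<rho> \<in> carrier_mat n n" by (simp add: \<rho>)
  have tr: "tr (\<rho> * \<sigma>) = complex_of_real c"
  proof -
    have "\<rho> * \<sigma> = E * (rdiag n (l 1) * X) * adj E"
      unfolding XE \<rho>E using Ec \<sigma>c E
      by (simp add: sq_mat_simps[where n = n] unitary_inverse)
    then have "tr (\<rho> * \<sigma>) = tr (rdiag n (l 1) * X)"
      using tr_unitary_conj[OF E mult_carrier_mat[OF rdiag_carrier Xc]] by simp
    also have "\<dots> = (\<Sum>i<n. complex_of_real (l 1 i) * X $$ (i,i))"
      using Xc by (auto simp: tr_def rdiag_mult_index[OF Xc] simp del: index_mult_mat(1))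
    also have "\<dots> = (\<Sum>i\<in>{0}. complex_of_real (l 1 i) * X $$ (i,i))"
      using n by (intro sum.mono_neutral_right) (auto simp: l_def)
    finally show ?thesis by (simp add: l_def X00)
  qed
  have "(\<rho> * S) * adj (\<rho> * S) = \<rho> * \<sigma> * adj \<rho>"
    using \<rho>c Sc Sa by (simp add: sq_mat_simps[where n = n] flip: SS)
  also have "\<dots> = E * (rdiag n (l 1) * X * rdiag n (l 1)) * adj E"
    unfolding XE \<rho>E spectral_adj[OF Ec Ec] using Ec \<sigma>c
    by (simp add: sq_mat_simps[where n = n])
  finally have AA: "(\<rho> * S) * adj (\<rho> * S) = E * rdiag n (l c) * adj E" unfolding DX .
  have suml: "(\<Sum>i<n. l c i powr q) = c powr q" for c q
  proof -
    have "(\<Sum>i<n. l c i powr q) = (\<Sum>i\<in>{0}. l c i powr q)"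
      using n by (intro sum.mono_neutral_right) (auto simp: l_def)
    then show ?thesis by (simp add: l_def)
  qed
  have 1: "schatten p (\<rho> * S) = sqrt c"
    using schatten_spectral[OF E _ AA, of p] c0 p
    by (simp add: suml powr_powr powr_half_sqrt) (simp add: l_def)
  have 2: "schatten p \<rho> = 1"
    unfolding \<rho>E using schatten_svd[OF E E, of "l 1" p] by (simp add: suml) (simp add: l_def)
  \<comment> \<open>Eigenvalues that sum to 1 lie between 0 and 1, where raising to the power
    \<open>p\<close> does not increase them.\<close>
  have "(\<Sum>i<n. m i powr p) \<le> (\<Sum>i<n. m i)"
  proof (rule sum_mono)
    fix i assume "i \<in> {..<n}"
    then have "m i \<le> (\<Sum>i<n. m i)" using m by (intro member_le_sum) auto
    then show "m i powr p \<le> m i" using m[of i] m1 p powr_mono'[of 1 p "m i"] by simp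
  qed
  then have "schatten p \<sigma> \<le> 1"
    unfolding \<sigma>G schatten_svd[OF G G m] using m1 p
    by (intro powr_le1) (auto simp: sum_nonneg)
  moreover have "schatten p \<sigma> \<ge> 0" by (simp add: schatten_def)
  ultimately have "(schatten p \<sigma>)\<^sup>2 \<le> 1" by (simp add: power_le_one)
  then have "Fp p \<rho> \<sigma> = c"
    unfolding Fp_def R S_def[symmetric] 1 2 using c0 by simp
  then show ?thesis using tr by simp
qed

text \<open>For the converse, square roots are stripped one at a time by
  \<open>adj_mult_self_eq_0\<close>, applied first to \<open>R * (S * S)\<close> and then to
  \<open>adj (R * S)\<close>.\<close>

lemma mult_sqrt_eq_0_iff:
  assumes R: "R \<in> carrier_mat n n" "adj R = R" and S: "S \<in> carrier_mat n n" "adj S = S"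
  shows "R * S = 0\<^sub>m n n \<longleftrightarrow> (R * R) * (S * S) = 0\<^sub>m n n"
proof
  assume 0: "R * S = 0\<^sub>m n n"
  have "(R * R) * (S * S) = R * (R * S) * S"
    using R S by (simp add: sq_mat_simps[where n = n])
  then show "(R * R) * (S * S) = 0\<^sub>m n n" using R S by (simp add: 0)
next
  have RSSc: "R * (S * S) \<in> carrier_mat n n" and RSc: "adj (R * S) \<in> carrier_mat n n"
    using R(1) S(1) by (simp_all add: mult_carrier_mat[of _ n n _ n])
  assume 0: "(R * R) * (S * S) = 0\<^sub>m n n"
  have "adj (R * (S * S)) * (R * (S * S)) = S * S * ((R * R) * (S * S))"
    using R S by (simp add: sq_mat_simps[where n = n])
  also have "\<dots> = 0\<^sub>m n n" unfolding 0 using S by (simp add: mult_carrier_mat[of _ n n _ n])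
  finally have RSS: "R * (S * S) = 0\<^sub>m n n"
    by (rule adj_mult_self_eq_0[OF RSSc])
  have "adj (adj (R * S)) * adj (R * S) = R * (S * S) * R"
    using R S by (simp add: sq_mat_simps[where n = n])
  also have "\<dots> = 0\<^sub>m n n" unfolding RSS using R by simp
  finally have "adj (R * S) = 0\<^sub>m n n"
    by (rule adj_mult_self_eq_0[OF RSc])
  then have "adj (adj (R * S)) = adj (0\<^sub>m n n)" by simp
  also have "adj (0\<^sub>m n n) = 0\<^sub>m n n" by (rule eq_matI) auto
  finally show "R * S = 0\<^sub>m n n" by simp
qed

theorem theorem2:
  fixes p :: real and n :: nat
  assumes "p \<ge> 1"
  shows "\<forall>\<rho> \<sigma>. density n \<rho> \<and> density n \<sigma> \<longrightarrow>
      (0 \<le> Fp p \<rho> \<sigma> \<and> Fp p \<rho> \<sigma> \<le> 1)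
    \<and> (Fp p \<rho> \<sigma> = 1 \<longleftrightarrow> \<rho> = \<sigma>)
    \<and> (Fp p \<rho> \<sigma> = 0 \<longleftrightarrow> \<rho> * \<sigma> = 0\<^sub>m n n)
    \<and> Fp p \<rho> \<sigma> = Fp p \<sigma> \<rho>
    \<and> (pure_state n \<rho> \<or> pure_state n \<sigma> \<longrightarrow> complex_of_real (Fp p \<rho> \<sigma>) = tr (\<rho> * \<sigma>))
    \<and> (\<forall>U. unitary n U \<longrightarrow>
          Fp p (U * \<rho> * adj U) (U * \<sigma> * adj U) = Fp p \<rho> \<sigma>)"
proof (intro allI impI, elim conjE)
  fix \<rho> \<sigma> assume dens: "density n \<rho>" "density n \<sigma>"
  have p: "p > 0" using assms by simp
  obtain E l where E: "unitary n E" and l: "\<And>i. l i \<ge> 0" and \<rho>: "\<rho> = E * rdiag n l * adj E"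
    and l1: "(\<Sum>i<n. l i) = 1"
    using density_spectral[OF dens(1)] by blast
  obtain G m where G: "unitary n G" and m: "\<And>i. m i \<ge> 0" and \<sigma>: "\<sigma> = G * rdiag n m * adj G"
    and m1: "(\<Sum>i<n. m i) = 1"
    using density_spectral[OF dens(2)] by blast
  note Ec = unitary_carrier[OF E] and Gc = unitary_carrier[OF G]
  define R S where "R = msqrt \<rho>" and "S = msqrt \<sigma>"
  have R: "R = E * rdiag n (\<lambda>i. sqrt (l i)) * adj E" unfolding R_def \<rho> by (rule msqrt_spectral[OF E l])
  have S: "S = G * rdiag n (\<lambda>i. sqrt (m i)) * adj G" unfolding S_def \<sigma> by (rule msqrt_spectral[OF G m])
  have Rc: "R \<in> carrier_mat n n" unfolding R using Ec by (auto simp: mult_carrier_mat[of _ n n _ n])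
  have Sc: "S \<in> carrier_mat n n" unfolding S using Gc by (auto simp: mult_carrier_mat[of _ n n _ n])
  have Ra: "adj R = R" unfolding R by (rule spectral_adj[OF Ec Ec])
  have Sa: "adj S = S" unfolding S by (rule spectral_adj[OF Gc Gc])
  have RR: "R * R = \<rho>" unfolding R spectral_mult[OF E] \<rho> by (simp add: l)
  have SS: "S * S = \<sigma>" unfolding S spectral_mult[OF G] \<sigma> by (simp add: m)
  obtain U V s where U: "unitary n U" and V: "unitary n V" and s: "\<And>i. s i \<ge> 0"
    and svd: "R * S = U * rdiag n s * adj V"
    using svd[of "R * S" n] Rc Sc by auto
  note Uc = unitary_carrier[OF U] and Vc = unitary_carrier[OF V]
  define x y z where "x = (\<Sum>i<n. s i powr p)" and "y = (\<Sum>i<n. l i powr p)" and "z = (\<Sum>i<n. m i powr p)"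
  have x: "x \<ge> 0" unfolding x_def by (intro sum_nonneg) auto
  have yz: "max y z > 0" unfolding y_def using sum_powr_pos[OF l l1, of p] by (simp add: less_max_iff_disj)
  have F: "Fp p \<rho> \<sigma> = (x / max y z) powr (2 / p)"
    unfolding x_def y_def z_def
    by (rule Fp_spectral[OF E G U V l m s p \<rho> \<sigma>]) (use svd in \<open>simp add: R_def S_def\<close>)
  have holder: "x \<le> max y z" "x = max y z \<Longrightarrow> R * U = S * V"
    using schatten_holder[OF E G U V l m s assms Rc _ Sc]
    by (simp_all add: Ra Sa RR SS \<rho> \<sigma> svd x_def y_def z_def)
  have "0 \<le> Fp p \<rho> \<sigma> \<and> Fp p \<rho> \<sigma> \<le> 1"
    unfolding F using x yz holder(1) p by (auto intro!: powr_le1)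
  moreover have "Fp p \<rho> \<sigma> = 1 \<longleftrightarrow> \<rho> = \<sigma>"
  proof
    assume "Fp p \<rho> \<sigma> = 1"
    \<comment> \<open>A ratio below 1 would have a power below 1, so fidelity 1 forces the equality
      case of the Hoelder bound.\<close>
    then have "\<not> x / max y z < 1"
      unfolding F using x yz p powr_less_mono2[of "2 / p" "x / max y z" 1] by auto
    then have "x = max y z" using yz holder(1) by (simp add: divide_less_eq)
    then have RU: "R * U = S * V" by (rule holder)
    \<comment> \<open>Multiplying by the adjoint removes the unitary and leaves the square of the
      root.\<close>
    have "R * U * adj (R * U) = \<rho>"
      unfolding RR[symmetric] using Rc Uc Ra unitary_cancel[OF U, of _ n]
      by (simp add: sq_mat_simps[where n = n])
    moreover have "S * V * adj (S * V) = \<sigma>"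
      unfolding SS[symmetric] using Sc Vc Sa unitary_cancel[OF V, of _ n]
      by (simp add: sq_mat_simps[where n = n])
    ultimately show "\<rho> = \<sigma>" by (simp add: RU)
  next
    assume eq: "\<rho> = \<sigma>"
    \<comment> \<open>The product of the two equal roots is \<open>\<rho>\<close>, whose spectral
      decomposition is already a singular value decomposition.\<close>
    have "Fp p \<rho> \<rho> = (y / max y y) powr (2 / p)"
      unfolding y_def
      by (rule Fp_spectral[OF E E E E l l l p \<rho> \<rho>]) (use RR \<rho> in \<open>simp add: R_def\<close>)
    then show "Fp p \<rho> \<sigma> = 1"
      using sum_powr_pos[OF l l1, of p] by (simp flip: eq add: y_def)
  qed
  moreover have "Fp p \<rho> \<sigma> = 0 \<longleftrightarrow> \<rho> * \<sigma> = 0\<^sub>m n n"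
  proof -
    \<comment> \<open>The fidelity vanishes exactly when all singular values of \<open>R * S\<close>
      do, that is, when \<open>R * S\<close> is zero.\<close>
    have "Fp p \<rho> \<sigma> = 0 \<longleftrightarrow> x = 0" unfolding F using yz by auto
    also have "\<dots> \<longleftrightarrow> (\<forall>i<n. s i = 0)" unfolding x_def by (subst sum_nonneg_eq_0_iff) auto
    also have "\<dots> \<longleftrightarrow> rdiag n s = 0\<^sub>m n n"
    proof
      assume "rdiag n s = 0\<^sub>m n n"
      then have "rdiag n s $$ (i,i) = 0" if "i < n" for i using that by simp
      then show "\<forall>i<n. s i = 0" by simp
    qed (auto intro!: eq_matI)
    also have "\<dots> \<longleftrightarrow> R * S = 0\<^sub>m n n"
    proof
      assume "R * S = 0\<^sub>m n n"
      then have "adj U * (U * rdiag n s * adj V) * V = 0\<^sub>m n n"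
        unfolding svd using Uc Vc by simp
      moreover have "adj U * (U * rdiag n s * adj V) * V = rdiag n s"
        using Uc Vc V unitary_cancel[OF U, of _ n]
        by (simp add: sq_mat_simps[where n = n] unitary_inverse)
      ultimately show "rdiag n s = 0\<^sub>m n n" by simp
    qed (use Uc Vc svd in simp)
    also have "\<dots> \<longleftrightarrow> \<rho> * \<sigma> = 0\<^sub>m n n"
      using mult_sqrt_eq_0_iff[OF Rc Ra Sc Sa] by (simp add: RR SS)
    finally show ?thesis .
  qed
  moreover have sym: "Fp p \<rho> \<sigma> = Fp p \<sigma> \<rho>"
  proof -
    \<comment> \<open>Swapping the states takes the adjoint of the product, which exchanges
      \<open>U\<close> and \<open>V\<close> but keeps the singular values.\<close>
    have "S * R = adj (R * S)" using Rc Sc Ra Sa by simp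
    also have "\<dots> = V * rdiag n s * adj U" unfolding svd by (rule spectral_adj[OF Uc Vc])
    finally have "msqrt \<sigma> * msqrt \<rho> = V * rdiag n s * adj U" by (simp add: R_def S_def)
    from Fp_spectral[OF G E V U m l s p \<sigma> \<rho> this]
    show ?thesis unfolding F x_def y_def z_def by (simp add: max.commute)
  qed
  moreover have "complex_of_real (Fp p \<rho> \<sigma>) = tr (\<rho> * \<sigma>)" if "pure_state n \<rho> \<or> pure_state n \<sigma>"
    using that
  proof
    assume "pure_state n \<rho>"
    then show ?thesis by (rule Fp_pure_state[OF _ dens(2) assms])
  next
    assume "pure_state n \<sigma>"
    then have "complex_of_real (Fp p \<sigma> \<rho>) = tr (\<sigma> * \<rho>)" by (rule Fp_pure_state[OF _ dens(1) assms])
    moreover have "tr (\<sigma> * \<rho>) = tr (\<rho> * \<sigma>)"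
      using dens by (intro tr_mult_comm[of _ n n]) (auto simp: density_def psd_def)
    ultimately show ?thesis by (simp add: sym)
  qed
  moreover have "Fp p (W * \<rho> * adj W) (W * \<sigma> * adj W) = Fp p \<rho> \<sigma>" if W: "unitary n W" for W
  proof -
    note Wc = unitary_carrier[OF W]
    \<comment> \<open>Conjugation by \<open>W\<close> is absorbed into the outer unitaries, so all
      spectra and singular values stay the same.\<close>
    have conj: "W * (A * rdiag n d * adj B) * adj W = (W * A) * rdiag n d * adj (W * B)"
      if "A \<in> carrier_mat n n" "B \<in> carrier_mat n n" for A B d
      using that Wc by (simp add: sq_mat_simps[where n = n])
    have WE: "unitary n (W * E)" and WG: "unitary n (W * G)"
      and WU: "unitary n (W * U)" and WV: "unitary n (W * V)"
      by (intro unitary_mult W E G U V)+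
    have "msqrt (W * \<rho> * adj W) = W * R * adj W"
      unfolding \<rho> R conj[OF Ec Ec] by (rule msqrt_spectral[OF WE l])
    moreover have "msqrt (W * \<sigma> * adj W) = W * S * adj W"
      unfolding \<sigma> S conj[OF Gc Gc] by (rule msqrt_spectral[OF WG m])
    moreover have "(W * R * adj W) * (W * S * adj W) = W * (R * S) * adj W"
      using Rc Sc Wc unitary_cancel[OF W, of _ n]
      by (simp add: sq_mat_simps[where n = n])
    ultimately have "msqrt (W * \<rho> * adj W) * msqrt (W * \<sigma> * adj W) = (W * U) * rdiag n s * adj (W * V)"
      by (simp only: svd conj[OF Uc Vc])
    from Fp_spectral[OF WE WG WU WV l m s p _ _ this]
    show ?thesis unfolding F x_def y_def z_def unfolding \<rho> \<sigma> conj[OF Ec Ec] conj[OF Gc Gc] by simp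
  qed
  ultimately show "(0 \<le> Fp p \<rho> \<sigma> \<and> Fp p \<rho> \<sigma> \<le> 1)
    \<and> (Fp p \<rho> \<sigma> = 1 \<longleftrightarrow> \<rho> = \<sigma>)
    \<and> (Fp p \<rho> \<sigma> = 0 \<longleftrightarrow> \<rho> * \<sigma> = 0\<^sub>m n n)
    \<and> Fp p \<rho> \<sigma> = Fp p \<sigma> \<rho>
    \<and> (pure_state n \<rho> \<or> pure_state n \<sigma> \<longrightarrow> complex_of_real (Fp p \<rho> \<sigma>) = tr (\<rho> * \<sigma>))
    \<and> (\<forall>U. unitary n U \<longrightarrow>
          Fp p (U * \<rho> * adj U) (U * \<sigma> * adj U) = Fp p \<rho> \<sigma>)"
    by blast
qed

end
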